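(* Let $A\in\mathcal{M}_n(\mathbb{C})$ be a normal matrix, let $\alpha,\beta\in\mathbb{R}$, and let the polygon $\langle\lambda_{(A)_1},\lambda_{(A)_2},\dots,\lambda_{(A)_k}\rangle$ be the numerical range of $A$. Let $x_j$ be a corresponding eigenvector of $\lambda_{(A)_j}$, $j=1,\dots,k$, and let $\upsilon=\sum_{j=1}^k\upsilon_jx_j$ be a unit vector. Denote by $E=\mathrm{span}\{\upsilon\}$ and by $E_W^{\perp}$ the orthogonal complement of $E$ with respect to $W=\mathrm{span}\{x_1,\dots,x_k\}$. Then $$NR[P^*\mathcal{L}(A,\alpha,\beta)P]=NR[\mathcal{L}(P^*AP,\alpha,\beta)]\subset\langle\lambda_{(\mathcal{L})_1},\lambda_{(\mathcal{L})_2},\dots,\lambda_{(\mathcal{L})_k}\rangle,$$ where $P=[\,w_1\ w_2\ \cdots\ w_{k-1}\,]$ and $w_1,\dots,w_{k-1}$ is an orthonormal basis of $E_W^{\perp}$. Moreover, $\partial NR[P^*\mathcal{L}(A,\alpha,\beta)P]$ is tangential to the edges of the polygon $\langle\lambda_{(\mathcal{L})_1},\dots,\lambda_{(\mathcal{L})_k}\rangle$ at the points $$\mu_{(\mathcal{L})_\tau}=\alpha\operatorname{Re}\mu_{(A)_\tau}+i\beta\operatorname{Im}\mu_{(A)_\tau}\qquad(\tau=1,\dots,k),$$ where $$\mu_{(A)_\tau}=\frac{|\upsilon_{\tau+1}|^2\lambda_{(A)_\tau}+|\upsilon_\tau|^2\lambda_{(A)_{\tau+1}}}{|\upsilon_{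\tau+1}|^2+|\upsilon_\tau|^2}\quad(\tau=1,\dots,k-1),\qquad\mu_{(A)_k}=\frac{|\upsilon_1|^2\lambda_{(A)_k}+|\upsilon_k|^2\lambda_{(A)_1}}{|\upsilon_1|^2+|\upsilon_k|^2}.$$
   Context: $\mathcal{M}_n(\mathbb{C})$ is the algebra of $n\times n$ complex matrices. The numerical range of an $m\times m$ matrix $B$ is $NR[B]=\{x^*Bx:\ x\in\mathbb{C}^m,\ x^*x=1\}$, with boundary $\partial NR[B]$. The generalized Levinger transformation of $B$ is $\mathcal{L}(B,\alpha,\beta)=\alpha H_B+\beta S_B$, where $H_B=\frac{B+B^*}{2}$, $S_B=\frac{B-B^*}{2}$. $\langle z_1,\dots,z_k\rangle$ denotes the (filled) convex polygon with consecutive vertices $z_1,\dots,z_k$. The $\lambda_{(A)_j}$ are eigenvalues of $A$, and $\lambda_{(\mathcal{L})_j}=\alpha\operatorname{Re}\lambda_{(A)_j}+i\beta\operatorname{Im}\lambda_{(A)_j}$ are the corresponding eigenvalues of the normal matrix $\mathcal{L}(A,\alpha,\beta)$.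
   Formalization: The eigenvectors x_j are taken to be unit vectors; μ_τ is considered only where υ_τ, υ_{τ+1} are not both zero; true tangency is claimed when all υ_j are nonzero, otherwise only that a line containing the edge supports the numerical range at that point. *)

theory Defs
  imports "HOL-Analysis.Analysis"
begin

definition hinner :: "complex ^ 'n \<Rightarrow> complex ^ 'n \<Rightarrow> complex" where
  "hinner x y = (\<Sum>i\<in>UNIV. cnj (x $ i) * y $ i)"

definition conj_transpose :: "complex ^ 'm ^ 'n \<Rightarrow> complex ^ 'n ^ 'm" where
  "conj_transpose B = (\<chi> i j. cnj (B $ j $ i))"

definition normal_matrix :: "complex ^ 'n ^ 'n \<Rightarrow> bool" where
  "normal_matrix A \<longleftrightarrow> A ** conj_transpose A = conj_transpose A ** A"

definition eigenvector :: "complex ^ 'n ^ 'n \<Rightarrow> complex ^ 'n \<Rightarrow> complex \<Rightarrow> bool" where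
  "eigenvector A x c \<longleftrightarrow> x \<noteq> 0 \<and> A *v x = c *s x"

definition numerical_range :: "complex ^ 'n ^ 'n \<Rightarrow> complex set" where
  "numerical_range B = {hinner x (B *v x) | x. hinner x x = 1}"

definition hermitian_part :: "complex ^ 'n ^ 'n \<Rightarrow> complex ^ 'n ^ 'n" where
  "hermitian_part B = (1 / 2) *\<^sub>R (B + conj_transpose B)"

definition skew_part :: "complex ^ 'n ^ 'n \<Rightarrow> complex ^ 'n ^ 'n" where
  "skew_part B = (1 / 2) *\<^sub>R (B - conj_transpose B)"

definition levinger :: "complex ^ 'n ^ 'n \<Rightarrow> real \<Rightarrow> real \<Rightarrow> complex ^ 'n ^ 'n" where
  "levinger B \<alpha> \<beta> = \<alpha> *\<^sub>R hermitian_part B + \<beta> *\<^sub>R skew_part B"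

definition levinger_point :: "complex \<Rightarrow> real \<Rightarrow> real \<Rightarrow> complex" where
  "levinger_point z \<alpha> \<beta> = Complex (\<alpha> * Re z) (\<beta> * Im z)"

definition orth_complement_in ::
    "(complex ^ 'n) set \<Rightarrow> (complex ^ 'n) set \<Rightarrow> (complex ^ 'n) set" where
  "orth_complement_in W E = {y \<in> W. \<forall>u\<in>E. hinner u y = 0}"

text \<open>Families of points are indexed by \<open>1, \<dots>, k\<close>, and the index \<open>k\<close> is followed by \<open>1\<close>.\<close>

definition cyclic_succ :: "nat \<Rightarrow> nat \<Rightarrow> nat" where
  "cyclic_succ k j = (if j = k then 1 else j + 1)"

definition polygon :: "nat \<Rightarrow> (nat \<Rightarrow> complex) \<Rightarrow> complex set" where
  "polygon k z = convex hull (z ` {1..k})"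

text \<open>Distinct points joined cyclically by one-dimensional faces of their convex hull: then
  these points are exactly the vertices of the hull, listed in (either) boundary order.  A
  segment is the case \<open>k = 2\<close>.\<close>

definition consecutive_vertices :: "nat \<Rightarrow> (nat \<Rightarrow> complex) \<Rightarrow> bool" where
  "consecutive_vertices k z \<longleftrightarrow> inj_on z {1..k} \<and>
     (\<forall>j\<in>{1..k}. closed_segment (z j) (z (cyclic_succ k j)) edge_of polygon k z)"

definition edge_point ::
    "nat \<Rightarrow> (nat \<Rightarrow> complex) \<Rightarrow> (nat \<Rightarrow> complex) \<Rightarrow> nat \<Rightarrow> complex" where
  "edge_point k c z j =
     (of_real ((cmod (c (cyclic_succ k j)))\<^sup>2) * z j +
      of_real ((cmod (c j))\<^sup>2) * z (cyclic_succ k j)) /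
     of_real ((cmod (c (cyclic_succ k j)))\<^sup>2 + (cmod (c j))\<^sup>2)"

text \<open>\<open>touching_line K p L\<close>: the line \<open>L\<close> meets the boundary of \<open>K\<close> at \<open>p\<close> and \<open>K\<close> lies on one
  side of it.  This alone does not exclude a corner of \<open>K\<close> at \<open>p\<close>.\<close>

definition touching_line :: "complex set \<Rightarrow> complex \<Rightarrow> complex set \<Rightarrow> bool" where
  "touching_line K p L \<longleftrightarrow> p \<in> frontier K \<and> p \<in> L \<and>
     (\<exists>c b. c \<noteq> 0 \<and> L = {z. c \<bullet> z = b} \<and> K \<subseteq> {z. c \<bullet> z \<le> b})"

text \<open>\<open>tangent_line C p L\<close>: the curve \<open>C\<close> passes through \<open>p\<close> and has \<open>L\<close> as its tangent line
  there, in the sense of first-order contact; for the boundary curve of a convex set this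
  rules out a corner at \<open>p\<close>.  It holds trivially if \<open>p\<close> is isolated in \<open>C\<close>.\<close>

definition tangent_line :: "complex set \<Rightarrow> complex \<Rightarrow> complex set \<Rightarrow> bool" where
  "tangent_line C p L \<longleftrightarrow> p \<in> C \<and> p \<in> L \<and> affine L \<and> aff_dim L = 1 \<and>
     ((\<lambda>z. infdist z L / dist z p) \<longlongrightarrow> 0) (at p within C)"

end

theory Submission
  imports Defs
begin

text \<open>
  A normal matrix and its adjoint share eigenvectors, with conjugate eigenvalues, so each
  \<open>x j\<close> is an eigenvector of \<open>levinger A \<alpha> \<beta>\<close> for the eigenvalue \<open>eigL j\<close>; the \<open>x j\<close> are
  orthonormal because the \<open>eig j\<close> are distinct.  In the coordinates that they give, the
  compression to the complement of \<open>\<upsilon>\<close> has an explicit numerical range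
  (\<open>numerical_range_compression\<close>): it consists of the averages of the \<open>eigL j\<close> with weights
  \<open>(cmod (y j))\<^sup>2\<close>, where \<open>y\<close> runs through the unit vectors orthogonal to \<open>c\<close>.  Such averages
  lie in the polygon.  If \<open>c\<close> does not vanish at both of two neighbouring indices, the vector
  supported on them and orthogonal to \<open>c\<close> is unique up to a scalar, and its average is the point \<open>\<mu>L \<tau>\<close> of the
  edge; so the line through the edge supports the numerical range and touches it there.

  The tangency rests on a description of the averages with three indices.  Orthogonality of
  \<open>y\<close> and \<open>c\<close> says that three complex numbers of squared moduli
  \<open>b j = (cmod (c j))\<^sup>2 * (cmod (y j))\<^sup>2\<close> add up to zero.  Their phases are free, so positive
  weights can be realised as soon as the three moduli are the sides of a triangle, that is,
  \<open>(b1 + b2 - b3)\<^sup>2 \<le> 4 * b1 * b2\<close> (Heron's formula).  With indices 1 and 2 at the ends of the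
  edge and 3 off its line, a point near \<open>\<mu>L \<tau>\<close> whose weights satisfy the strict inequality is
  interior.  A frontier point near \<open>\<mu>L \<tau>\<close> and off the line must violate it, and this gives
  \<open>b3 * B \<le> (b1 - b2)\<^sup>2\<close> with a constant \<open>B > 0\<close>.  Here \<open>b3\<close> is proportional to the distance
  from the line of the edge, and \<open>b1 - b2\<close> is an affine function that vanishes at
  \<open>\<mu>L \<tau>\<close>: the frontier leaves the line at most quadratically
  (\<open>frontier_quadratic_contact\<close>).

  For \<open>\<alpha> \<noteq> 0\<close> and \<open>\<beta> \<noteq> 0\<close> the map \<open>levinger_point\<close> is a linear isomorphism of the plane and
  carries the edges of the polygon to edges.  If \<open>\<alpha> = 0\<close> or \<open>\<beta> = 0\<close>, everything lies
  on one coordinate axis, and that axis is the tangent line.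
\<close>

section \<open>Weighted averages over a hyperplane of coordinate vectors\<close>

text \<open>The numerical range of the diagonal form with entries \<open>z 1, \<dots>, z k\<close>, restricted to the
  hyperplane orthogonal to \<open>c\<close>.\<close>
definition hyperplane_range :: "nat \<Rightarrow> (nat \<Rightarrow> complex) \<Rightarrow> (nat \<Rightarrow> complex) \<Rightarrow> complex set" where
  "hyperplane_range k c z =
     {\<Sum>j = 1..k. of_real ((cmod (y j))\<^sup>2) * z j | y.
        (\<Sum>j = 1..k. (cmod (y j))\<^sup>2) = 1 \<and> (\<Sum>j = 1..k. cnj (c j) * y j) = 0}"

lemma hyperplane_range_subset_polygon: "hyperplane_range k c z \<subseteq> polygon k z"
proof
  fix p assume "p \<in> hyperplane_range k c z"
  then obtain y where y: "p = (\<Sum>j = 1..k. (cmod (y j))\<^sup>2 *\<^sub>R z j)" "(\<Sum>j = 1..k. (cmod (y j))\<^sup>2) = 1"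
    by (auto simp: hyperplane_range_def scaleR_conv_of_real)
  show "p \<in> polygon k z"
    unfolding y(1) polygon_def
    by (rule convex_sum) (use y(2) in \<open>auto intro: hull_inc\<close>)
qed

lemma edge_weights_pos:
  assumes "c j \<noteq> 0 \<or> c j' \<noteq> 0"
  shows "(cmod (c j'))\<^sup>2 + (cmod (c j))\<^sup>2 > 0"
  using assms by (metis add_pos_nonneg add_nonneg_pos norm_eq_zero zero_less_power2 zero_le_power2)

lemma edge_weights_sum:
  assumes "c j \<noteq> 0 \<or> c j' \<noteq> 0"
  shows "(cmod (c j'))\<^sup>2 / ((cmod (c j'))\<^sup>2 + (cmod (c j))\<^sup>2) +
    (cmod (c j))\<^sup>2 / ((cmod (c j'))\<^sup>2 + (cmod (c j))\<^sup>2) = 1"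
  using edge_weights_pos[of c j j', OF assms] by (metis add_divide_distrib divide_self less_irrefl)

lemma edge_point_eq_weighted_sum:
  "edge_point k c z j =
    ((cmod (c (cyclic_succ k j)))\<^sup>2 / ((cmod (c (cyclic_succ k j)))\<^sup>2 + (cmod (c j))\<^sup>2)) *\<^sub>R z j +
    ((cmod (c j))\<^sup>2 / ((cmod (c (cyclic_succ k j)))\<^sup>2 + (cmod (c j))\<^sup>2)) *\<^sub>R z (cyclic_succ k j)"
  by (simp add: edge_point_def scaleR_conv_of_real add_divide_distrib)

lemma edge_point_in_closed_segment:
  assumes "c j \<noteq> 0 \<or> c (cyclic_succ k j) \<noteq> 0"
  shows "edge_point k c z j \<in> closed_segment (z j) (z (cyclic_succ k j))"
  unfolding edge_point_eq_weighted_sum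
  by (rule convexD[OF convex_closed_segment])
    (use edge_weights_sum[of c j "cyclic_succ k j", OF assms] in \<open>simp_all del: divide_self_if\<close>)

lemma cyclic_succ_in: "j \<in> {1..k} \<Longrightarrow> cyclic_succ k j \<in> {1..k}"
  by (auto simp: cyclic_succ_def)

lemma cyclic_succ_neq: "k \<ge> 2 \<Longrightarrow> cyclic_succ k j \<noteq> j"
  by (auto simp: cyclic_succ_def)

text \<open>Coordinates outside \<open>S\<close> are filled up with zeros, so a point is exhibited by giving a
  vector on two or three indices only.\<close>
lemma hyperplane_rangeI:
  assumes S: "S \<subseteq> {1..k}"
    and unit: "(\<Sum>j\<in>S. (cmod (y j))\<^sup>2) = 1" and orth: "(\<Sum>j\<in>S. cnj (c j) * y j) = 0"
  shows "(\<Sum>j\<in>S. of_real ((cmod (y j))\<^sup>2) * z j) \<in> hyperplane_range k c z"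
proof -
  let ?y = "\<lambda>j. if j \<in> S then y j else 0"
  have "(\<Sum>j = 1..k. (cmod (?y j))\<^sup>2) = (\<Sum>j\<in>S. (cmod (y j))\<^sup>2)"
    by (rule sum.mono_neutral_cong_right) (use S in auto)
  moreover have "(\<Sum>j = 1..k. cnj (c j) * ?y j) = (\<Sum>j\<in>S. cnj (c j) * y j)"
    by (rule sum.mono_neutral_cong_right) (use S in auto)
  moreover have "(\<Sum>j = 1..k. of_real ((cmod (?y j))\<^sup>2) * z j)
      = (\<Sum>j\<in>S. of_real ((cmod (y j))\<^sup>2) * z j)"
    by (rule sum.mono_neutral_cong_right) (use S in auto)
  ultimately show ?thesis
    unfolding hyperplane_range_def using unit orth by (intro CollectI exI[of _ ?y]) simp
qed

text \<open>The witness \<open>(cnj (c j'), - cnj (c j))\<close>, normalised, spans the vectors orthogonal to \<open>c\<close>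
  that live on the two indices; taking squared moduli swaps the weights, as in
  \<open>edge_point\<close>.\<close>
lemma edge_point_in_hyperplane_range:
  assumes "k \<ge> 2" "j \<in> {1..k}" "c j \<noteq> 0 \<or> c (cyclic_succ k j) \<noteq> 0"
  shows "edge_point k c z j \<in> hyperplane_range k c z"
proof -
  let ?s = "cyclic_succ k j"
  let ?r = "(cmod (c ?s))\<^sup>2 + (cmod (c j))\<^sup>2"
  define y where "y = (\<lambda>i. (if i = j then cnj (c ?s) else - cnj (c j)) / of_real (sqrt ?r))"
  have pos: "?r > 0"
    using assms(3) by (rule edge_weights_pos)
  have s: "?s \<in> {1..k}" "?s \<noteq> j"
    using assms(1,2) cyclic_succ_in cyclic_succ_neq by blast+
  have sq: "(cmod (y j))\<^sup>2 = (cmod (c ?s))\<^sup>2 / ?r" "(cmod (y ?s))\<^sup>2 = (cmod (c j))\<^sup>2 / ?r"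
    using s pos by (simp_all add: y_def norm_divide power_divide)
  have "(\<Sum>i\<in>{j, ?s}. of_real ((cmod (y i))\<^sup>2) * z i) \<in> hyperplane_range k c z"
  proof (rule hyperplane_rangeI)
    show "{j, ?s} \<subseteq> {1..k}" using s assms(2) by simp
    show "(\<Sum>i\<in>{j, ?s}. (cmod (y i))\<^sup>2) = 1"
      using s edge_weights_sum[of c j ?s, OF assms(3)] by (simp add: sq)
    show "(\<Sum>i\<in>{j, ?s}. cnj (c i) * y i) = 0"
      using s by (simp add: y_def mult.commute)
  qed
  also have "(\<Sum>i\<in>{j, ?s}. of_real ((cmod (y i))\<^sup>2) * z i) = edge_point k c z j"
    using s by (simp add: sq edge_point_def add_divide_distrib del: of_real_power)
  finally show ?thesis .
qed

text \<open>A triangle with squared side lengths \<open>b1\<close>, \<open>b2\<close>, \<open>b3\<close>: the inequality is the condition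
  that the cosine of the angle between the first two sides, which the law of cosines
  prescribes, lies between \<open>-1\<close> and \<open>1\<close>.\<close>
lemma ex_triangle:
  fixes b1 b2 b3 :: real
  assumes "b1 > 0" "b2 > 0" "b3 \<ge> 0" "(b1 + b2 - b3)\<^sup>2 \<le> 4 * b1 * b2"
  obtains v1 v2 v3 :: complex
  where "v1 + v2 + v3 = 0" "(cmod v1)\<^sup>2 = b1" "(cmod v2)\<^sup>2 = b2" "(cmod v3)\<^sup>2 = b3"
proof
  \<comment> \<open>the real part of the second side, when the first lies on the positive real axis\<close>
  define t where "t = (b3 - b1 - b2) / (2 * sqrt b1)"
  have t: "t\<^sup>2 \<le> b2"
  proof -
    have "t\<^sup>2 = (b1 + b2 - b3)\<^sup>2 / (4 * b1)"
      using assms by (simp add: t_def power_divide power_mult_distrib) (simp add: power2_eq_square algebra_simps)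
    also have "\<dots> \<le> b2" using assms by (simp add: divide_simps mult.commute)
    finally show ?thesis .
  qed
  let ?v1 = "complex_of_real (sqrt b1)" and ?v2 = "Complex t (sqrt (b2 - t\<^sup>2))"
  show "?v1 + ?v2 + (- (?v1 + ?v2)) = 0" by simp
  show "(cmod ?v1)\<^sup>2 = b1" using assms by simp
  show "(cmod ?v2)\<^sup>2 = b2" using t by (simp add: cmod_power2)
  have "2 * (t * sqrt b1) = b3 - b1 - b2" using assms by (simp add: t_def)
  moreover have "(cmod (- (?v1 + ?v2)))\<^sup>2 = b1 + 2 * (t * sqrt b1) + b2"
  proof -
    have "(cmod (- (?v1 + ?v2)))\<^sup>2 = (sqrt b1 + t)\<^sup>2 + (sqrt (b2 - t\<^sup>2))\<^sup>2"
      unfolding norm_minus_cancel by (simp add: cmod_power2)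
    then show ?thesis using assms t by (simp add: power2_sum algebra_simps)
  qed
  ultimately show "(cmod (- (?v1 + ?v2)))\<^sup>2 = b3" by simp
qed

text \<open>A closed triangle with sides \<open>v1\<close>, \<open>v2\<close>, \<open>v3\<close> supplies the summands \<open>cnj (c i) * y i\<close> of
  the orthogonality relation; dividing by \<open>cnj (c i)\<close> turns squared lengths into the
  prescribed weights.\<close>
lemma three_weights_in_hyperplane_range:
  assumes idx: "i1 \<in> {1..k}" "i2 \<in> {1..k}" "i3 \<in> {1..k}" "i1 \<noteq> i2" "i3 \<noteq> i1" "i3 \<noteq> i2"
    and c: "c i1 \<noteq> 0" "c i2 \<noteq> 0" "c i3 \<noteq> 0"
    and w: "w1 > 0" "w2 > 0" "w3 \<ge> 0" "w1 + w2 + w3 = 1"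
    and b: "b1 = (cmod (c i1))\<^sup>2 * w1" "b2 = (cmod (c i2))\<^sup>2 * w2" "b3 = (cmod (c i3))\<^sup>2 * w3"
    and tri: "(b1 + b2 - b3)\<^sup>2 \<le> 4 * b1 * b2"
  shows "w1 *\<^sub>R z i1 + w2 *\<^sub>R z i2 + w3 *\<^sub>R z i3 \<in> hyperplane_range k c z"
proof -
  have "b1 > 0" "b2 > 0" "b3 \<ge> 0" using b c w by simp_all
  then obtain v1 v2 v3 :: complex where v: "v1 + v2 + v3 = 0"
    "(cmod v1)\<^sup>2 = b1" "(cmod v2)\<^sup>2 = b2" "(cmod v3)\<^sup>2 = b3"
    using ex_triangle tri by metis
  define y where "y = (\<lambda>i. if i = i1 then v1 / cnj (c i1) else if i = i2 then v2 / cnj (c i2)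
    else v3 / cnj (c i3))"
  have y_val: "y i1 = v1 / cnj (c i1)" "y i2 = v2 / cnj (c i2)" "y i3 = v3 / cnj (c i3)"
    using idx by (auto simp: y_def)
  have sq: "(cmod (y i1))\<^sup>2 = w1" "(cmod (y i2))\<^sup>2 = w2" "(cmod (y i3))\<^sup>2 = w3"
    using c v b by (simp_all add: y_val norm_divide power_divide)
  have "(\<Sum>i\<in>{i1, i2, i3}. of_real ((cmod (y i))\<^sup>2) * z i) \<in> hyperplane_range k c z"
  proof (rule hyperplane_rangeI)
    show "{i1, i2, i3} \<subseteq> {1..k}" using idx by simp
    show "(\<Sum>i\<in>{i1, i2, i3}. (cmod (y i))\<^sup>2) = 1" using idx w(4) by (simp add: sq)
    show "(\<Sum>i\<in>{i1, i2, i3}. cnj (c i) * y i) = 0"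
      using idx c v(1) by (simp add: y_val add.assoc)
  qed
  also have "(\<Sum>i\<in>{i1, i2, i3}. of_real ((cmod (y i))\<^sup>2) * z i)
      = w1 *\<^sub>R z i1 + w2 *\<^sub>R z i2 + w3 *\<^sub>R z i3"
    using idx by (simp add: sq scaleR_conv_of_real add.assoc del: of_real_power)
  finally show ?thesis .
qed

section \<open>Supporting lines and quadratic contact\<close>

lemma exists_nonzero_orthogonal: "\<exists>a. a \<noteq> 0 \<and> a \<bullet> d = 0" for d :: complex
proof (cases "d = 0")
  case False
  have "(\<i> * d) \<bullet> d = 0" by (simp add: inner_complex_def)
  with False show ?thesis by (intro exI[of _ "\<i> * d"]) simp
qed (auto intro: exI[of _ 1])

text \<open>Faces of a polytope are exposed, which yields the line.  The one exception is an edge that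
  fills the whole polygon (the case \<open>k = 2\<close>): exposedness then gives no direction, and any
  line containing the segment will do.\<close>
lemma supporting_line_of_edge:
  assumes cv: "consecutive_vertices k z" and j: "j \<in> {1..k}"
  obtains a b where "a \<noteq> 0" "a \<bullet> z j = b" "a \<bullet> z (cyclic_succ k j) = b"
    "\<And>p. p \<in> polygon k z \<Longrightarrow> a \<bullet> p \<le> b"
proof -
  let ?e = "closed_segment (z j) (z (cyclic_succ k j))"
  have face: "?e face_of polygon k z"
    using cv j by (auto simp: consecutive_vertices_def edge_of_def)
  have "polyhedron (polygon k z)"
    unfolding polygon_def by (intro polytope_imp_polyhedron polytope_convex_hull) simp
  then have "?e exposed_face_of polygon k z"
    using face by (simp add: exposed_face_of_polyhedron)
  then consider "?e = polygon k z"
    | a b where "a \<noteq> 0" "polygon k z \<subseteq> {x. a \<bullet> x \<le> b}" "?e = polygon k z \<inter> {x. a \<bullet> x = b}"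
    unfolding exposed_face_of by auto
  then show thesis
  proof cases
    case 1
    obtain a where a: "a \<noteq> 0" "a \<bullet> (z (cyclic_succ k j) - z j) = 0"
      using exists_nonzero_orthogonal by blast
    have "a \<bullet> p = a \<bullet> z j" if "p \<in> ?e" for p
    proof -
      obtain u where "p = (1 - u) *\<^sub>R z j + u *\<^sub>R z (cyclic_succ k j)"
        using \<open>p \<in> ?e\<close> by (auto simp: in_segment)
      then have "p = z j + u *\<^sub>R (z (cyclic_succ k j) - z j)" by (simp add: algebra_simps)
      then show ?thesis using a(2) by (simp add: inner_add_right)
    qed
    then show thesis using 1 a(1) by (intro that[of a "a \<bullet> z j"]) auto
  next
    case (2 a b)
    have "z j \<in> ?e" "z (cyclic_succ k j) \<in> ?e" by auto
    then show thesis using 2 by (intro that[of a b]) auto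
  qed
qed

lemma parallel_complex:
  fixes a d u :: complex
  assumes "a \<noteq> 0" "a \<bullet> d = 0" "a \<bullet> u = 0" "d \<noteq> 0"
  shows "u = ((d \<bullet> u) / (d \<bullet> d)) *\<^sub>R d"
proof -
  have cross: "Re d * Im u = Im d * Re u"
  proof -
    have "Re a * (Re d * Im u - Im d * Re u) = 0" "Im a * (Re d * Im u - Im d * Re u) = 0"
      using assms(2,3) unfolding inner_complex_def by algebra+
    then show ?thesis using \<open>a \<noteq> 0\<close> by (auto simp: complex_eq_iff)
  qed
  have "(d \<bullet> d) *\<^sub>R u = (d \<bullet> u) *\<^sub>R d"
  proof (rule complex_eqI)
    show "Re ((d \<bullet> d) *\<^sub>R u) = Re ((d \<bullet> u) *\<^sub>R d)"
      using cross by (simp add: inner_complex_def) algebra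
    show "Im ((d \<bullet> d) *\<^sub>R u) = Im ((d \<bullet> u) *\<^sub>R d)"
      using cross by (simp add: inner_complex_def) algebra
  qed
  then have "inverse (d \<bullet> d) *\<^sub>R ((d \<bullet> d) *\<^sub>R u) = inverse (d \<bullet> d) *\<^sub>R ((d \<bullet> u) *\<^sub>R d)"
    by simp
  then show ?thesis
    using \<open>d \<noteq> 0\<close> by (simp add: divide_inverse mult.commute)
qed

text \<open>The vectors \<open>e1\<close>, \<open>e2\<close>, \<open>e3\<close> are the gradients of the barycentric coordinates of the
  triangle \<open>z1\<close>, \<open>z2\<close>, \<open>z3\<close>: a displacement \<open>h\<close> changes the weights by \<open>e1 \<bullet> h\<close>, \<open>e2 \<bullet> h\<close>,
  \<open>e3 \<bullet> h\<close>.  The third is explicit because the third weight measures the distance from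
  the line through \<open>z1\<close> and \<open>z2\<close>.\<close>
lemma barycentric_coordinates:
  fixes a z1 z2 z3 :: complex
  assumes "a \<noteq> 0" "a \<bullet> z1 = b" "a \<bullet> z2 = b" "a \<bullet> z3 \<noteq> b" "z1 \<noteq> z2"
  obtains e1 e2 e3 where "e3 = (- 1 / (b - a \<bullet> z3)) *\<^sub>R a"
    "\<And>h. e1 \<bullet> h + e2 \<bullet> h + e3 \<bullet> h = 0"
    "\<And>h. (e1 \<bullet> h) *\<^sub>R z1 + (e2 \<bullet> h) *\<^sub>R z2 + (e3 \<bullet> h) *\<^sub>R z3 = h"
proof -
  define g where "g = b - a \<bullet> z3"
  define d where "d = z2 - z1"
  define e3 where "e3 = (- 1 / g) *\<^sub>R a"
  define e2 where "e2 = (1 / (d \<bullet> d)) *\<^sub>R d - ((d \<bullet> (z3 - z1)) / (d \<bullet> d)) *\<^sub>R e3"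
  define e1 where "e1 = - e2 - e3"
  have g: "g \<noteq> 0" and d: "d \<noteq> 0" using assms by (auto simp: g_def d_def)
  show thesis
  proof
    show "e3 = (- 1 / (b - a \<bullet> z3)) *\<^sub>R a" by (simp add: e3_def g_def)
    show "e1 \<bullet> h + e2 \<bullet> h + e3 \<bullet> h = 0" for h by (simp add: e1_def inner_diff_left)
    fix h
    \<comment> \<open>removing the part along \<open>z3 - z1\<close> leaves a vector parallel to the line\<close>
    define u where "u = h - (e3 \<bullet> h) *\<^sub>R (z3 - z1)"
    have "a \<bullet> (z3 - z1) = - g" using assms(2) by (simp add: g_def inner_diff_right)
    then have "a \<bullet> u = 0" using g by (simp add: u_def e3_def inner_add_right)
    then have "u = ((d \<bullet> u) / (d \<bullet> d)) *\<^sub>R d"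
      using assms d by (intro parallel_complex[of a]) (auto simp: d_def inner_diff_right)
    also have "(d \<bullet> u) / (d \<bullet> d) = e2 \<bullet> h"
      by (simp add: u_def e2_def inner_diff_left inner_diff_right[of _ h] diff_divide_distrib)
    finally show "(e1 \<bullet> h) *\<^sub>R z1 + (e2 \<bullet> h) *\<^sub>R z2 + (e3 \<bullet> h) *\<^sub>R z3 = h"
      by (simp add: u_def d_def e1_def inner_diff_left algebra_simps)
  qed
qed

lemma infdist_hyperplane_le:
  fixes a z :: "'a::euclidean_space"
  assumes "a \<noteq> 0"
  shows "infdist z {x. a \<bullet> x = b} \<le> \<bar>a \<bullet> z - b\<bar> / norm a"
proof -
  let ?q = "z - ((a \<bullet> z - b) / (a \<bullet> a)) *\<^sub>R a"
  have "infdist z {x. a \<bullet> x = b} \<le> dist z ?q"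
    using assms by (intro infdist_le) (simp add: inner_diff_right)
  also have "\<dots> = \<bar>a \<bullet> z - b\<bar> / norm a"
    using assms by (simp add: dist_norm power2_norm_eq_inner[symmetric] power2_eq_square)
  finally show ?thesis .
qed

text \<open>tangency\<close>
text \<open>The frontier stays close to the supporting line because points with positive weights
  that satisfy the triangle inequality strictly are interior.  In barycentric coordinates
  around \<open>p\<close>, with \<open>b i\<close> the weight \<open>w i\<close> scaled by \<open>(cmod (c i))\<^sup>2\<close>,
  \<open>4 * b1 * b2 - (b1 + b2 - b3)\<^sup>2 = b3 * (2 * b1 + 2 * b2 - b3) - (b1 - b2)\<^sup>2\<close>.
  If this is not positive, then, close to \<open>p\<close>, \<open>b3\<close> is bounded by a multiple of \<open>(b1 - b2)\<^sup>2\<close>, hence of the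
  squared distance from \<open>p\<close>.\<close>
lemma frontier_quadratic_contact:
  assumes idx: "i1 \<in> {1..k}" "i2 \<in> {1..k}" "i3 \<in> {1..k}" "i1 \<noteq> i2"
    and c: "c i1 \<noteq> 0" "c i2 \<noteq> 0" "c i3 \<noteq> 0"
    and a: "a \<noteq> 0" "a \<bullet> z i1 = b" "a \<bullet> z i2 = b" "a \<bullet> z i3 < b" "z i1 \<noteq> z i2"
    and below: "\<And>p. p \<in> hyperplane_range k c z \<Longrightarrow> a \<bullet> p \<le> b"
    and q: "q1 > 0" "q2 > 0" "q1 + q2 = 1" "(cmod (c i1))\<^sup>2 * q1 = (cmod (c i2))\<^sup>2 * q2"
    and p: "p = q1 *\<^sub>R z i1 + q2 *\<^sub>R z i2"
  shows "\<exists>M. \<forall>\<^sub>F z' in at p within frontier (hyperplane_range k c z).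
      b - a \<bullet> z' \<le> M * (dist z' p)\<^sup>2"
proof -
  let ?K = "hyperplane_range k c z"
  define g where "g = b - a \<bullet> z i3"
  have g: "g > 0" using a by (simp add: g_def)
  obtain e1 e2 e3 where e3: "e3 = (- 1 / g) *\<^sub>R a"
    and e_sum: "\<And>h. e1 \<bullet> h + e2 \<bullet> h + e3 \<bullet> h = 0"
    and e_bary: "\<And>h. (e1 \<bullet> h) *\<^sub>R z i1 + (e2 \<bullet> h) *\<^sub>R z i2 + (e3 \<bullet> h) *\<^sub>R z i3 = h"
    using barycentric_coordinates[of a "z i1" b "z i2" "z i3"] a unfolding g_def by (metis less_irrefl)
  define w1 where "w1 = (\<lambda>z'. q1 + e1 \<bullet> (z' - p))"
  define w2 where "w2 = (\<lambda>z'. q2 + e2 \<bullet> (z' - p))"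
  define w3 where "w3 = (\<lambda>z'. e3 \<bullet> (z' - p))"
  define b1 where "b1 = (\<lambda>z'. (cmod (c i1))\<^sup>2 * w1 z')"
  define b2 where "b2 = (\<lambda>z'. (cmod (c i2))\<^sup>2 * w2 z')"
  define b3 where "b3 = (\<lambda>z'. (cmod (c i3))\<^sup>2 * w3 z')"
  have w_sum: "w1 z' + w2 z' + w3 z' = 1" for z'
    using e_sum[of "z' - p"] q(3) by (simp add: w1_def w2_def w3_def)
  have w_bary: "w1 z' *\<^sub>R z i1 + w2 z' *\<^sub>R z i2 + w3 z' *\<^sub>R z i3 = z'" for z'
    using e_bary[of "z' - p"] by (simp add: w1_def w2_def w3_def p algebra_simps)
  have w3: "w3 z' = (b - a \<bullet> z') / g" for z'
  proof -
    have "a \<bullet> p = (q1 + q2) * b" using a by (simp add: p inner_add_right algebra_simps)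
    then show ?thesis using q(3) by (simp add: w3_def e3 inner_diff_right diff_divide_distrib)
  qed
  note defs = w1_def w2_def w3_def b1_def b2_def b3_def
  have cont: "continuous_on UNIV w1" "continuous_on UNIV w2" "continuous_on UNIV w3"
    "continuous_on UNIV b1" "continuous_on UNIV b2" "continuous_on UNIV b3"
    unfolding defs by (intro continuous_intros)+
  define B where "B = b1 p"
  have B: "B > 0" "b2 p = B" "b3 p = 0"
    using c q by (simp_all add: B_def defs)
  \<comment> \<open>the points whose weights are realised with room to spare\<close>
  define U where "U = {z'. 0 < w1 z' \<and> 0 < w2 z' \<and> 0 < w3 z' \<and> (b1 z' + b2 z' - b3 z')\<^sup>2 < 4 * b1 z' * b2 z'}"
  have "open U"
    unfolding U_def by (intro open_Collect_conj open_Collect_less continuous_intros cont)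
  moreover have "U \<subseteq> ?K"
  proof
    fix z' assume "z' \<in> U"
    then have "w1 z' *\<^sub>R z i1 + w2 z' *\<^sub>R z i2 + w3 z' *\<^sub>R z i3 \<in> ?K"
      using idx c a w_sum by (intro three_weights_in_hyperplane_range) (auto simp: U_def b1_def b2_def b3_def)
    then show "z' \<in> ?K" by (simp add: w_bary)
  qed
  ultimately have U: "z' \<notin> U" if "z' \<in> frontier ?K" for z'
    using that interior_maximal[of U ?K] by (auto simp: frontier_def)
  have closed: "a \<bullet> z' \<le> b" if "z' \<in> closure ?K" for z'
  proof -
    have "closure ?K \<subseteq> {z'. a \<bullet> z' \<le> b}"
      using below by (intro closure_minimal closed_halfspace_le) auto
    with that show ?thesis by blast
  qed
  \<comment> \<open>a neighbourhood of \<open>p\<close>: at \<open>p\<close> the last inequality reads \<open>B < 4 * B\<close>\<close>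
  define V where "V = {z'. 0 < w1 z' \<and> 0 < w2 z' \<and> B < 2 * b1 z' + 2 * b2 z' - b3 z'}"
  have "open V"
    unfolding V_def by (intro open_Collect_conj open_Collect_less continuous_intros cont)
  moreover have "p \<in> V" using B q by (simp add: V_def B_def[symmetric]) (simp add: defs)
  ultimately have near: "\<forall>\<^sub>F z' in at p within frontier ?K. z' \<in> V \<and> z' \<in> frontier ?K"
    by (auto simp: eventually_at_topological)
  \<comment> \<open>the gradient of \<open>b1 - b2\<close>, which vanishes at \<open>p\<close> by the choice of \<open>q1\<close> and \<open>q2\<close>\<close>
  define m where "m = (cmod (c i1))\<^sup>2 *\<^sub>R e1 - (cmod (c i2))\<^sup>2 *\<^sub>R e2"
  have diff: "b1 z' - b2 z' = m \<bullet> (z' - p)" for z'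
    using q(4) by (simp add: b1_def b2_def w1_def w2_def m_def inner_diff_left algebra_simps)
  let ?M = "g * (norm m)\<^sup>2 / (B * (cmod (c i3))\<^sup>2)"
  have "b - a \<bullet> z' \<le> ?M * (dist z' p)\<^sup>2" if "z' \<in> V" "z' \<in> frontier ?K" for z'
  proof -
    have w3_nonneg: "w3 z' \<ge> 0"
      using closed[of z'] that(2) g by (simp add: w3 frontier_def)
    have "b3 z' * B \<le> (b1 z' - b2 z')\<^sup>2"
    proof (cases "w3 z' = 0")
      case False
      then have "4 * b1 z' * b2 z' \<le> (b1 z' + b2 z' - b3 z')\<^sup>2"
        using U[OF that(2)] that(1) w3_nonneg by (auto simp: U_def V_def)
      then have "b3 z' * (2 * b1 z' + 2 * b2 z' - b3 z') \<le> (b1 z' - b2 z')\<^sup>2"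
        by (simp add: power2_eq_square algebra_simps)
      moreover have "b3 z' * B \<le> b3 z' * (2 * b1 z' + 2 * b2 z' - b3 z')"
        using that(1) w3_nonneg by (intro mult_left_mono) (auto simp: V_def b3_def)
      ultimately show ?thesis by linarith
    qed (simp add: b3_def)
    also have "\<dots> \<le> (norm m * dist z' p)\<^sup>2"
      unfolding diff dist_norm by (simp add: Cauchy_Schwarz_ineq2 abs_le_square_iff[symmetric])
    finally show ?thesis
      using B(1) c(3) g by (simp add: b3_def w3 field_simps)
  qed
  then show ?thesis
    using near by (intro exI[of _ ?M]) (auto elim: eventually_mono)
qed

text \<open>Quadratic contact is stronger than tangency: the quotient of the two distances is at most
  a multiple of the distance from \<open>p\<close>.\<close>
lemma tangent_line_hyperplane:
  fixes a :: complex
  assumes a: "a \<noteq> 0" and p: "p \<in> C" "a \<bullet> p = b"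
    and below: "\<And>z. z \<in> C \<Longrightarrow> a \<bullet> z \<le> b"
    and contact: "\<forall>\<^sub>F z in at p within C. b - a \<bullet> z \<le> M * (dist z p)\<^sup>2"
  shows "tangent_line C p {z. a \<bullet> z = b}"
proof -
  let ?L = "{z. a \<bullet> z = b}"
  have "((\<lambda>z. infdist z ?L / dist z p) \<longlongrightarrow> 0) (at p within C)"
  proof (rule tendsto_sandwich)
    show "\<forall>\<^sub>F z in at p within C. 0 \<le> infdist z ?L / dist z p"
      by (simp add: infdist_nonneg)
    have "\<forall>\<^sub>F z in at p within C. z \<noteq> p \<and> z \<in> C"
      by (auto simp: eventually_at_topological)
    with contact show "\<forall>\<^sub>F z in at p within C. infdist z ?L / dist z p \<le> (M / norm a) * dist z p"
    proof eventually_elim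
      case (elim z)
      then have "infdist z ?L \<le> M * (dist z p)\<^sup>2 / norm a"
        using infdist_hyperplane_le[OF a, of z b] below[of z] a
        by (auto simp: abs_if divide_right_mono elim!: order_trans)
      then show ?case
        using elim a by (simp add: divide_le_eq power2_eq_square mult_ac)
    qed
    show "((\<lambda>z. (M / norm a) * dist z p) \<longlongrightarrow> 0) (at p within C)"
      by (rule tendsto_eq_intros refl)+ simp
  qed simp
  then show ?thesis
    using a p by (simp add: tangent_line_def affine_hyperplane)
qed

lemma touching_line_hyperplane:
  fixes a :: complex
  assumes a: "a \<noteq> 0" and p: "p \<in> K" "a \<bullet> p = b" and below: "\<And>z. z \<in> K \<Longrightarrow> a \<bullet> z \<le> b"
  shows "touching_line K p {z. a \<bullet> z = b}"
proof -
  have "interior K \<subseteq> interior {z. a \<bullet> z \<le> b}"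
    by (rule interior_mono) (use below in auto)
  then have "p \<notin> interior K"
    using a p by (auto simp: interior_halfspace_le)
  then have "p \<in> frontier K"
    using p closure_subset[of K] by (auto simp: frontier_def)
  then show ?thesis
    using a p below unfolding touching_line_def by blast
qed

text \<open>The last but one hypothesis covers both shapes that occur: a genuine edge, or points
  \<open>z i\<close> that all lie on the line, where the two ends of the edge may coincide.  On a line the
  frontier has contact of every order; otherwise some \<open>z i\<close> off the line serves as the third
  vertex of \<open>frontier_quadratic_contact\<close>.\<close>
lemma support_line_tangent:
  assumes k: "k \<ge> 2" and j: "j \<in> {1..k}"
    and a: "a \<noteq> 0" "a \<bullet> z j = b" "a \<bullet> z (cyclic_succ k j) = b"
    and below: "\<And>i. i \<in> {1..k} \<Longrightarrow> a \<bullet> z i \<le> b"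
    and nondeg: "z j \<noteq> z (cyclic_succ k j) \<or> (\<forall>i\<in>{1..k}. a \<bullet> z i = b)"
    and cj: "c j \<noteq> 0 \<or> c (cyclic_succ k j) \<noteq> 0"
  shows "\<exists>L. closed_segment (z j) (z (cyclic_succ k j)) \<subseteq> L \<and>
      touching_line (hyperplane_range k c z) (edge_point k c z j) L \<and>
      ((\<forall>i\<in>{1..k}. c i \<noteq> 0) \<longrightarrow>
        tangent_line (frontier (hyperplane_range k c z)) (edge_point k c z j) L)"
proof -
  let ?K = "hyperplane_range k c z" and ?p = "edge_point k c z j" and ?s = "cyclic_succ k j"
  let ?L = "{p. a \<bullet> p = b}"
  have polygon_subset: "polygon k z \<subseteq> S" if "convex S" "\<And>i. i \<in> {1..k} \<Longrightarrow> z i \<in> S" for S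
    unfolding polygon_def by (rule hull_minimal) (use that in auto)
  have K_below: "?K \<subseteq> {p. a \<bullet> p \<le> b}"
    using hyperplane_range_subset_polygon polygon_subset[OF convex_halfspace_le] below by blast
  have frontier_sub: "frontier ?K \<subseteq> S" if "?K \<subseteq> S" "closed S" for S
    using closure_minimal[OF that] by (auto simp: frontier_def)
  have seg: "closed_segment (z j) (z ?s) \<subseteq> ?L"
    by (rule closed_segment_subset) (use a in \<open>auto intro: convex_hyperplane\<close>)
  then have p: "?p \<in> ?K" "a \<bullet> ?p = b"
    using edge_point_in_closed_segment[OF cj] edge_point_in_hyperplane_range[OF k j cj] by auto
  have touch: "touching_line ?K ?p ?L"
    using touching_line_hyperplane a(1) p K_below by blast
  moreover have "tangent_line (frontier ?K) ?p ?L" if c: "\<forall>i\<in>{1..k}. c i \<noteq> 0"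
  proof -
    have "\<exists>M. \<forall>\<^sub>F z' in at ?p within frontier ?K. b - a \<bullet> z' \<le> M * (dist z' ?p)\<^sup>2"
    proof (cases "\<forall>i\<in>{1..k}. a \<bullet> z i = b")
      case True
      then have "polygon k z \<subseteq> ?L"
        by (intro polygon_subset convex_hyperplane) auto
      then have "frontier ?K \<subseteq> ?L"
        using hyperplane_range_subset_polygon[of k c z] by (intro frontier_sub closed_hyperplane) blast
      then show ?thesis
        by (intro exI[of _ 0]) (auto simp: eventually_at_topological)
    next
      case False
      then obtain i where i: "i \<in> {1..k}" "a \<bullet> z i < b"
        using below by (metis order_less_le)
      have s: "?s \<in> {1..k}" "?s \<noteq> j"
        using k j cyclic_succ_in cyclic_succ_neq by blast+
      define r where "r = (cmod (c ?s))\<^sup>2 + (cmod (c j))\<^sup>2"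
      have nz: "c j \<noteq> 0" "c ?s \<noteq> 0" "c i \<noteq> 0" using c j s(1) i(1) by blast+
      have r: "r > 0" using edge_weights_pos[of c j ?s, OF cj] by (simp add: r_def)
      show ?thesis
      proof (rule frontier_quadratic_contact[OF j s(1) i(1) s(2)[symmetric] nz a i(2)])
        show "z j \<noteq> z ?s" using nondeg False by blast
        show "a \<bullet> q \<le> b" if "q \<in> ?K" for q using that K_below by blast
        show "(cmod (c ?s))\<^sup>2 / r > 0" "(cmod (c j))\<^sup>2 / r > 0"
          using nz r by simp_all
        show "(cmod (c ?s))\<^sup>2 / r + (cmod (c j))\<^sup>2 / r = 1"
          unfolding r_def using cj by (rule edge_weights_sum)
        show "(cmod (c j))\<^sup>2 * ((cmod (c ?s))\<^sup>2 / r) = (cmod (c ?s))\<^sup>2 * ((cmod (c j))\<^sup>2 / r)"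
          by simp
        show "?p = ((cmod (c ?s))\<^sup>2 / r) *\<^sub>R z j + ((cmod (c j))\<^sup>2 / r) *\<^sub>R z ?s"
          unfolding r_def by (rule edge_point_eq_weighted_sum)
      qed
    qed
    then obtain M where "\<forall>\<^sub>F z' in at ?p within frontier ?K. b - a \<bullet> z' \<le> M * (dist z' ?p)\<^sup>2" ..
    moreover have "?p \<in> frontier ?K" using touch by (simp add: touching_line_def)
    moreover have "a \<bullet> z' \<le> b" if "z' \<in> frontier ?K" for z'
      using that frontier_sub[OF K_below closed_halfspace_le] by blast
    ultimately show ?thesis
      using tangent_line_hyperplane[OF a(1) _ p(2)] by blast
  qed
  ultimately show ?thesis using seg by blast
qed

section \<open>Linear images of polygons\<close>

lemma linear_levinger_point: "linear (\<lambda>z. levinger_point z \<alpha> \<beta>)"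
  by (rule linearI) (simp_all add: levinger_point_def complex_eq_iff algebra_simps)

lemma edge_point_linear_image:
  assumes "linear f"
  shows "edge_point k c (\<lambda>j. f (z j)) j = f (edge_point k c z j)"
  by (simp add: edge_point_eq_weighted_sum linear_add[OF assms] linear_scale[OF assms])

lemma consecutive_vertices_linear_image:
  assumes cv: "consecutive_vertices k z" and f: "linear f" "inj f"
  shows "consecutive_vertices k (\<lambda>j. f (z j))"
proof -
  have "polygon k (\<lambda>j. f (z j)) = f ` polygon k z"
    by (simp add: polygon_def convex_hull_linear_image[OF f(1)] image_image)
  then have "closed_segment (f (z j)) (f (z (cyclic_succ k j))) edge_of polygon k (\<lambda>j. f (z j))"
    if "j \<in> {1..k}" for j
    using cv that f
    by (auto simp: consecutive_vertices_def edge_of_def closed_segment_linear_image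
        face_of_linear_image)
  moreover have "inj_on (\<lambda>j. f (z j)) {1..k}"
    using cv f(2) unfolding consecutive_vertices_def inj_on_def by blast
  ultimately show ?thesis by (simp add: consecutive_vertices_def)
qed

lemma consecutive_vertices_levinger_point:
  assumes "consecutive_vertices k z" "\<alpha> \<noteq> 0" "\<beta> \<noteq> 0"
  shows "consecutive_vertices k (\<lambda>j. levinger_point (z j) \<alpha> \<beta>)"
  using assms(1) linear_levinger_point
proof (rule consecutive_vertices_linear_image)
  show "inj (\<lambda>z. levinger_point z \<alpha> \<beta>)"
    using assms(2,3) by (auto simp: inj_def levinger_point_def complex_eq_iff)
qed

section \<open>Eigenvectors of the Levinger transformation\<close>

lemma hinner_sum_scale_left:
  "hinner (\<Sum>j\<in>I. y j *s x j) u = (\<Sum>j\<in>I. cnj (y j) * hinner (x j) u)"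
proof -
  have "hinner (\<Sum>j\<in>I. y j *s x j) u = (\<Sum>i\<in>UNIV. \<Sum>j\<in>I. cnj (y j) * (cnj (x j $ i) * u $ i))"
    by (simp add: hinner_def sum_distrib_right mult.assoc)
  also have "\<dots> = (\<Sum>j\<in>I. cnj (y j) * hinner (x j) u)"
    by (subst sum.swap) (simp add: hinner_def sum_distrib_left)
  finally show ?thesis .
qed

lemma hinner_sum_scale_right:
  "hinner u (\<Sum>j\<in>I. y j *s x j) = (\<Sum>j\<in>I. y j * hinner u (x j))"
proof -
  have "hinner u (\<Sum>j\<in>I. y j *s x j) = (\<Sum>i\<in>UNIV. \<Sum>j\<in>I. y j * (cnj (u $ i) * x j $ i))"
    by (simp add: hinner_def sum_distrib_left mult.left_commute)
  also have "\<dots> = (\<Sum>j\<in>I. y j * hinner u (x j))"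
    by (subst sum.swap) (simp add: hinner_def sum_distrib_left)
  finally show ?thesis .
qed

lemma hinner_scale_left: "hinner (a *s u) v = cnj a * hinner u v"
  by (simp add: hinner_def sum_distrib_left mult.assoc)

lemma hinner_scale_right: "hinner u (a *s v) = a * hinner u v"
  by (simp add: hinner_def sum_distrib_left mult.left_commute)

lemma hinner_diff_left: "hinner (u - u') v = hinner u v - hinner u' v"
  by (simp add: hinner_def sum_subtractf left_diff_distrib)

lemma hinner_diff_right: "hinner u (v - v') = hinner u v - hinner u v'"
  by (simp add: hinner_def sum_subtractf right_diff_distrib)

lemma hinner_self: "hinner u u = of_real ((norm u)\<^sup>2)"
proof -
  have "hinner u u = (\<Sum>i\<in>UNIV. of_real ((cmod (u $ i))\<^sup>2))"
    unfolding hinner_def by (rule sum.cong) (simp_all only: complex_norm_square mult.commute)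
  also have "\<dots> = of_real ((norm u)\<^sup>2)"
    by (simp add: norm_vec_def L2_set_def sum_nonneg)
  finally show ?thesis .
qed

lemma conj_transpose_conj_transpose: "conj_transpose (conj_transpose B) = B"
  by (simp add: conj_transpose_def vec_eq_iff)

lemma conj_transpose_mult: "conj_transpose (B ** C) = conj_transpose C ** conj_transpose B"
  by (simp add: conj_transpose_def matrix_matrix_mult_def vec_eq_iff mult.commute)

lemma hinner_conj_transpose_right: "hinner u (conj_transpose B *v v) = hinner (B *v u) v"
proof -
  have "hinner u (conj_transpose B *v v) = (\<Sum>i\<in>UNIV. \<Sum>j\<in>UNIV. cnj (u $ i) * (cnj (B $ j $ i) * v $ j))"
    by (simp add: hinner_def conj_transpose_def matrix_vector_mult_def sum_distrib_left)
  also have "\<dots> = (\<Sum>j\<in>UNIV. \<Sum>i\<in>UNIV. cnj (u $ i) * (cnj (B $ j $ i) * v $ j))"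
    by (rule sum.swap)
  also have "\<dots> = hinner (B *v u) v"
    by (simp add: hinner_def matrix_vector_mult_def sum_distrib_left sum_distrib_right mult_ac)
  finally show ?thesis .
qed

lemma hinner_conj_transpose_left: "hinner (conj_transpose B *v u) v = hinner u (B *v v)"
  using hinner_conj_transpose_right[of u "conj_transpose B" v]
  by (simp add: conj_transpose_conj_transpose)

text \<open>By normality \<open>A\<close> and its adjoint map each vector to vectors of equal norm; expanding the squared
  norm of \<open>conj_transpose A *v x - cnj z *s x\<close> then gives zero.\<close>
lemma conj_transpose_eigenvector:
  assumes normal: "normal_matrix A" and eig: "A *v x = z *s x"
  shows "conj_transpose A *v x = cnj z *s x"
proof -
  let ?d = "conj_transpose A *v x - cnj z *s x"
  have "hinner (conj_transpose A *v x) (conj_transpose A *v x)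
      = hinner x (A ** conj_transpose A *v x)"
    by (simp add: hinner_conj_transpose_left matrix_vector_mul_assoc)
  also have "\<dots> = hinner (A *v x) (A *v x)"
    using normal
    by (simp add: normal_matrix_def hinner_conj_transpose_right flip: matrix_vector_mul_assoc)
  finally have "hinner (conj_transpose A *v x) (conj_transpose A *v x) = cnj z * (z * hinner x x)"
    by (simp add: eig hinner_scale_left hinner_scale_right mult.assoc)
  moreover have "hinner (conj_transpose A *v x) x = z * hinner x x"
    by (simp add: hinner_conj_transpose_left eig hinner_scale_right)
  moreover have "hinner x (conj_transpose A *v x) = cnj z * hinner x x"
    by (simp add: hinner_conj_transpose_right eig hinner_scale_left)
  ultimately have "hinner ?d ?d = 0"
    by (simp add: hinner_diff_left hinner_diff_right hinner_scale_left hinner_scale_right)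
  then show ?thesis
    by (simp add: hinner_self)
qed

lemma normal_eigenvectors_orthogonal:
  assumes "normal_matrix A" "A *v x = z *s x" "A *v x' = z' *s x'" "z \<noteq> z'"
  shows "hinner x x' = 0"
proof -
  have "z' * hinner x x' = hinner (conj_transpose A *v x) x'"
    by (simp add: hinner_conj_transpose_left assms(3) hinner_scale_right)
  also have "\<dots> = z * hinner x x'"
    by (simp add: conj_transpose_eigenvector[OF assms(1,2)] hinner_scale_left)
  finally show ?thesis using assms(4) by simp
qed

text \<open>Written as a combination of \<open>B\<close> and its adjoint, the transformation visibly commutes with
  compressions, and its effect on the eigenvalues of a normal matrix can be read off from
  the analogous formula for \<open>levinger_point\<close>.\<close>
lemma levinger_alt:
  "levinger B \<alpha> \<beta> = ((\<alpha> + \<beta>) / 2) *\<^sub>R B + ((\<alpha> - \<beta>) / 2) *\<^sub>R conj_transpose B"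
proof -
  have "levinger B \<alpha> \<beta> = (\<alpha>/2) *\<^sub>R B + (\<alpha>/2) *\<^sub>R conj_transpose B
      + ((\<beta>/2) *\<^sub>R B - (\<beta>/2) *\<^sub>R conj_transpose B)"
    by (simp add: levinger_def hermitian_part_def skew_part_def
        scaleR_right_distrib scaleR_right_diff_distrib)
  then show ?thesis
    by (simp add: add_divide_distrib diff_divide_distrib scaleR_left_distrib scaleR_left_diff_distrib)
qed

lemma levinger_point_alt:
  "levinger_point z \<alpha> \<beta> = of_real ((\<alpha> + \<beta>) / 2) * z + of_real ((\<alpha> - \<beta>) / 2) * cnj z"
  by (simp add: levinger_point_def complex_eq_iff field_simps)

lemma scaleR_matrix_vector: "(r *\<^sub>R B) *v x = of_real r *s (B *v (x :: complex ^ 'n))"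
  by (simp add: matrix_vector_mult_def vec_eq_iff scaleR_sum_right
      flip: scaleR_conv_of_real)

lemma levinger_eigenvector:
  assumes "normal_matrix A" "A *v x = z *s x"
  shows "levinger A \<alpha> \<beta> *v x = levinger_point z \<alpha> \<beta> *s x"
  unfolding levinger_alt levinger_point_alt
  by (simp add: matrix_vector_mult_add_rdistrib scaleR_matrix_vector assms(2)
      conj_transpose_eigenvector[OF assms] vector_sadd_rdistrib vector_smult_assoc)

lemma matrix_mult_scaleR_right:
  "C ** (r *\<^sub>R B) = r *\<^sub>R (C ** (B :: complex ^ 'c ^ 'a))"
  by (simp add: matrix_matrix_mult_def vec_eq_iff scaleR_sum_right)

lemma matrix_mult_scaleR_left:
  "(r *\<^sub>R B) ** C = r *\<^sub>R ((B :: complex ^ 'c ^ 'a) ** C)"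
  by (simp add: matrix_matrix_mult_def vec_eq_iff scaleR_sum_right)

lemma matrix_mult_add_left: "(B + C) ** D = B ** D + C ** (D :: complex ^ 'c ^ 'a)"
  by (simp add: matrix_matrix_mult_def vec_eq_iff distrib_right sum.distrib)

lemma levinger_compression:
  "levinger (conj_transpose P ** A ** P) \<alpha> \<beta> = conj_transpose P ** levinger A \<alpha> \<beta> ** P"
  by (simp add: levinger_alt matrix_add_ldistrib matrix_mult_add_left
      matrix_mult_scaleR_right matrix_mult_scaleR_left
      conj_transpose_mult conj_transpose_conj_transpose matrix_mul_assoc)

section \<open>The numerical range of a compression\<close>

lemma vec_span_image_finite:
  fixes f :: "'i \<Rightarrow> 'a :: field ^ 'n"
  assumes "finite I"
  shows "vec.span (f ` I) = {\<Sum>i\<in>I. y i *s f i | y. True}" (is "_ = ?R")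
proof
  have "vec.subspace ?R"
  proof (rule vec.subspaceI)
    show "0 \<in> ?R"
      by (rule CollectI, rule exI[of _ "\<lambda>_. 0"]) simp
  next
    fix u v assume "u \<in> ?R" "v \<in> ?R"
    then obtain y y' where "u = (\<Sum>i\<in>I. y i *s f i)" "v = (\<Sum>i\<in>I. y' i *s f i)" by blast
    then have "u + v = (\<Sum>i\<in>I. (y i + y' i) *s f i)"
      by (simp add: vector_sadd_rdistrib sum.distrib)
    then show "u + v \<in> ?R" by (intro CollectI exI[of _ "\<lambda>i. y i + y' i"]) simp
  next
    fix c u assume "u \<in> ?R"
    then obtain y where "u = (\<Sum>i\<in>I. y i *s f i)" by blast
    then have "c *s u = (\<Sum>i\<in>I. (c * y i) *s f i)"
      by (simp add: vec.scale_sum_right)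
    then show "c *s u \<in> ?R" by (intro CollectI exI[of _ "\<lambda>i. c * y i"]) simp
  qed
  moreover have "f ` I \<subseteq> ?R"
  proof
    fix u assume "u \<in> f ` I"
    then obtain i where "i \<in> I" "u = f i" by blast
    moreover from this have "(\<Sum>j\<in>I. (if j = i then 1 else 0) *s f j) = (\<Sum>j\<in>I. if j = i then f j else 0)"
      by (intro sum.cong) auto
    ultimately have "u = (\<Sum>j\<in>I. (if j = i then 1 else 0) *s f j)"
      using assms by simp
    then show "u \<in> ?R" by (intro CollectI exI[of _ "\<lambda>j. if j = i then 1 else 0"]) simp
  qed
  ultimately show "vec.span (f ` I) \<subseteq> ?R" by (rule vec.span_minimal[rotated])
  show "?R \<subseteq> vec.span (f ` I)"
    by (auto intro!: vec.span_sum vec.span_scale intro: vec.span_base)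
qed

text \<open>The matrix \<open>P\<close> maps unit vectors onto the unit vectors of its column space, and this is
  the set of combinations of the \<open>x j\<close> that are orthogonal to the one with coefficients \<open>c\<close>.
  In the orthonormal coordinates given by the \<open>x j\<close> the form of \<open>B\<close> is diagonal.\<close>
lemma numerical_range_compression:
  fixes w :: "'m::finite \<Rightarrow> complex ^ 'n" and x :: "nat \<Rightarrow> complex ^ 'n"
  assumes x: "\<And>i j. \<lbrakk>i \<in> {1..k}; j \<in> {1..k}\<rbrakk> \<Longrightarrow> hinner (x i) (x j) = (if i = j then 1 else 0)"
    and B: "\<And>j. j \<in> {1..k} \<Longrightarrow> B *v x j = z j *s x j"
    and w: "\<And>i j. hinner (w i) (w j) = (if i = j then 1 else 0)"
    and span: "vec.span (range w) =
      orth_complement_in (vec.span (x ` {1..k})) (vec.span {\<Sum>j = 1..k. c j *s x j})"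
    and P: "P = (\<chi> i j. w j $ i)"
  shows "numerical_range (conj_transpose P ** B ** P) = hyperplane_range k c z"
proof -
  have Pv: "P *v v = (\<Sum>j\<in>UNIV. v $ j *s w j)" for v
    by (simp add: P matrix_vector_mult_def vec_eq_iff mult.commute)
  have isometry: "hinner (P *v v) (P *v v) = hinner v v" for v
  proof -
    have "hinner (P *v v) (P *v v)
        = (\<Sum>j\<in>UNIV. v $ j * (\<Sum>i\<in>UNIV. cnj (v $ i) * (if i = j then 1 else 0)))"
      by (simp only: Pv hinner_sum_scale_left hinner_sum_scale_right w)
    also have "\<dots> = hinner v v"
      by (simp add: hinner_def mult.commute if_distrib cong: if_cong)
    finally show ?thesis .
  qed
  have form: "hinner v ((conj_transpose P ** B ** P) *v v) = hinner (P *v v) (B *v (P *v v))" for v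
    by (simp add: hinner_conj_transpose_right flip: matrix_vector_mul_assoc)
  have range_P: "range (\<lambda>v. P *v v) = vec.span (range w)"
  proof
    show "range (\<lambda>v. P *v v) \<subseteq> vec.span (range w)"
      by (auto simp: Pv intro!: vec.span_sum vec.span_scale intro: vec.span_base)
    show "vec.span (range w) \<subseteq> range (\<lambda>v. P *v v)"
    proof
      fix u assume "u \<in> vec.span (range w)"
      then obtain y where "u = (\<Sum>i\<in>UNIV. y i *s w i)"
        by (auto simp: vec_span_image_finite)
      then have "u = P *v (\<chi> i. y i)" by (simp add: Pv)
      then show "u \<in> range (\<lambda>v. P *v v)" by blast
    qed
  qed
  let ?X = "\<lambda>y. \<Sum>j = 1..k. y j *s x j"
  have coord: "hinner (x i) (?X y) = y i" if "i \<in> {1..k}" for i y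
  proof -
    have "hinner (x i) (?X y) = (\<Sum>j = 1..k. if i = j then y j else 0)"
      unfolding hinner_sum_scale_right by (rule sum.cong) (use x that in auto)
    then show ?thesis using that by simp
  qed
  have pairing: "hinner (?X a) (?X y) = (\<Sum>j = 1..k. cnj (a j) * y j)" for a y
    unfolding hinner_sum_scale_left by (rule sum.cong) (use coord in auto)
  have BX: "B *v ?X y = ?X (\<lambda>j. y j * z j)" for y
  proof -
    have "B *v ?X y = (\<Sum>j = 1..k. y j *s (B *v x j))"
      by (simp add: vec.linear_sum vec.linear_scale)
    also have "\<dots> = ?X (\<lambda>j. y j * z j)"
      by (rule sum.cong) (use B in auto)
    finally show ?thesis .
  qed
  have sq: "cnj a * a = of_real ((cmod a)\<^sup>2)" for a :: complex
    by (simp only: complex_norm_square mult.commute)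
  have norm_X: "hinner (?X y) (?X y) = of_real (\<Sum>j = 1..k. (cmod (y j))\<^sup>2)" for y
    by (simp only: pairing sq of_real_sum)
  have form_X: "hinner (?X y) (B *v ?X y) = (\<Sum>j = 1..k. of_real ((cmod (y j))\<^sup>2) * z j)" for y
    by (simp only: BX pairing sq mult.assoc[symmetric])
  have span_P: "range (\<lambda>v. P *v v) = {?X y | y. (\<Sum>j = 1..k. cnj (c j) * y j) = 0}"
  proof -
    have perp: "(\<forall>u\<in>vec.span {b}. hinner u v = 0) \<longleftrightarrow> hinner b v = 0" for b v :: "complex ^ 'n"
      by (auto simp: vec.span_singleton hinner_scale_left intro: exI[of _ 1])
    have "range (\<lambda>v. P *v v) = {u \<in> {?X y | y. True}. hinner (?X c) u = 0}"
      unfolding range_P span orth_complement_in_def vec_span_image_finite[OF finite_atLeastAtMost] perp ..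
    also have "\<dots> = {?X y | y. hinner (?X c) (?X y) = 0}" by blast
    finally show ?thesis unfolding pairing .
  qed
  have "numerical_range (conj_transpose P ** B ** P)
      = {hinner u (B *v u) | u. u \<in> range (\<lambda>v. P *v v) \<and> hinner u u = 1}"
    unfolding numerical_range_def form using isometry by (auto; metis)
  also have "\<dots> = {hinner (?X y) (B *v ?X y) | y.
      hinner (?X y) (?X y) = 1 \<and> (\<Sum>j = 1..k. cnj (c j) * y j) = 0}"
    unfolding span_P by auto
  also have "\<dots> = hyperplane_range k c z"
    unfolding hyperplane_range_def form_X norm_X of_real_eq_1_iff ..
  finally show ?thesis .
qed

section \<open>Tangency to the edges of the transformed polygon\<close>

theorem proposition4:
  fixes A :: "complex ^ 'n ^ 'n"
    and P :: "complex ^ 'm ^ 'n"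
    and \<alpha> \<beta> :: real
    and k :: nat
    and eig :: "nat \<Rightarrow> complex"
    and x :: "nat \<Rightarrow> complex ^ 'n"
    and \<upsilon> :: "complex ^ 'n"
    and c :: "nat \<Rightarrow> complex"
    and w :: "'m \<Rightarrow> complex ^ 'n"
    and W E :: "(complex ^ 'n) set"
    and eigL \<mu> \<mu>L :: "nat \<Rightarrow> complex"
  assumes "normal_matrix A"
    and "k \<ge> 2"
    and "consecutive_vertices k eig"
    and "numerical_range A = polygon k eig"
    and "\<And>j. j \<in> {1..k} \<Longrightarrow> eigenvector A (x j) (eig j) \<and> norm (x j) = 1"
    and "\<upsilon> = (\<Sum>j = 1..k. c j *s x j)"
    and "norm \<upsilon> = 1"
    and "E = vec.span {\<upsilon>}"
    and "W = vec.span (x ` {1..k})"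
    and "CARD('m) = k - 1"
    and "\<And>i j. hinner (w i) (w j) = (if i = j then 1 else 0)"
    and "vec.span (range w) = orth_complement_in W E"
    and "P = (\<chi> i j. w j $ i)"
    and "eigL = (\<lambda>j. levinger_point (eig j) \<alpha> \<beta>)"
    and "\<mu> = edge_point k c eig"
    and "\<mu>L = (\<lambda>\<tau>. levinger_point (\<mu> \<tau>) \<alpha> \<beta>)"
  shows "numerical_range (conj_transpose P ** levinger A \<alpha> \<beta> ** P) =
           numerical_range (levinger (conj_transpose P ** A ** P) \<alpha> \<beta>) \<and>
         numerical_range (levinger (conj_transpose P ** A ** P) \<alpha> \<beta>) \<subseteq> polygon k eigL \<and>
         (\<alpha> \<noteq> 0 \<and> \<beta> \<noteq> 0 \<longrightarrow> consecutive_vertices k eigL) \<and>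
         (\<forall>\<tau>\<in>{1..k}. c \<tau> \<noteq> 0 \<or> c (cyclic_succ k \<tau>) \<noteq> 0 \<longrightarrow>
           \<mu>L \<tau> \<in> closed_segment (eigL \<tau>) (eigL (cyclic_succ k \<tau>)) \<and>
           (\<exists>L. closed_segment (eigL \<tau>) (eigL (cyclic_succ k \<tau>)) \<subseteq> L \<and>
              touching_line (numerical_range (conj_transpose P ** levinger A \<alpha> \<beta> ** P)) (\<mu>L \<tau>) L \<and>
              ((\<forall>j\<in>{1..k}. c j \<noteq> 0) \<longrightarrow>
                 tangent_line (frontier (numerical_range (conj_transpose P ** levinger A \<alpha> \<beta> ** P)))
                   (\<mu>L \<tau>) L)))"
proof -
  let ?K = "numerical_range (conj_transpose P ** levinger A \<alpha> \<beta> ** P)"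
  note normal = assms(1) and k = assms(2) and cv = assms(3) and eigL = assms(14)
  have eigv: "A *v x j = eig j *s x j" if "j \<in> {1..k}" for j
    using assms(5)[OF that] by (simp add: eigenvector_def)
  have "inj_on eig {1..k}" using cv by (simp add: consecutive_vertices_def)
  then have orthonormal: "hinner (x i) (x j) = (if i = j then 1 else 0)"
    if "i \<in> {1..k}" "j \<in> {1..k}" for i j
    using that assms(5) normal_eigenvectors_orthogonal[OF normal eigv eigv]
    by (auto simp: hinner_self inj_on_eq_iff simp del: atLeastAtMost_iff)
  have K: "?K = hyperplane_range k c eigL"
  proof (rule numerical_range_compression[OF orthonormal])
    show "levinger A \<alpha> \<beta> *v x j = eigL j *s x j" if "j \<in> {1..k}" for j
      unfolding eigL by (rule levinger_eigenvector[OF normal eigv[OF that]])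
    show "vec.span (range w)
        = orth_complement_in (vec.span (x ` {1..k})) (vec.span {\<Sum>j = 1..k. c j *s x j})"
      using assms(6,8,9,12) by simp
  qed (use assms(11,13) in auto)
  have muL: "\<mu>L \<tau> = edge_point k c eigL \<tau>" for \<tau>
    using assms(15,16) eigL by (simp add: edge_point_linear_image[OF linear_levinger_point])
  have vertices: "consecutive_vertices k eigL" if "\<alpha> \<noteq> 0" "\<beta> \<noteq> 0"
    unfolding eigL by (rule consecutive_vertices_levinger_point[OF cv that])
  have support: "\<exists>a b. a \<noteq> 0 \<and> a \<bullet> eigL \<tau> = b \<and> a \<bullet> eigL (cyclic_succ k \<tau>) = b \<and>
      (\<forall>i\<in>{1..k}. a \<bullet> eigL i \<le> b) \<and>
      (eigL \<tau> \<noteq> eigL (cyclic_succ k \<tau>) \<or> (\<forall>i\<in>{1..k}. a \<bullet> eigL i = b))"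
    if \<tau>: "\<tau> \<in> {1..k}" for \<tau>
  proof -
    consider "\<alpha> = 0" | "\<beta> = 0" | "\<alpha> \<noteq> 0" "\<beta> \<noteq> 0" by blast
    then show ?thesis
    proof cases
      case 1
      \<comment> \<open>all points are on the imaginary axis\<close>
      then show ?thesis
        by (intro exI[of _ 1] exI[of _ 0]) (simp add: eigL levinger_point_def inner_complex_def)
    next
      case 2
      \<comment> \<open>all points are on the real axis\<close>
      then show ?thesis
        by (intro exI[of _ \<i>] exI[of _ 0]) (simp add: eigL levinger_point_def inner_complex_def)
    next
      case 3
      then obtain a b where "a \<noteq> 0" "a \<bullet> eigL \<tau> = b" "a \<bullet> eigL (cyclic_succ k \<tau>) = b"
        "\<And>p. p \<in> polygon k eigL \<Longrightarrow> a \<bullet> p \<le> b"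
        using supporting_line_of_edge[OF vertices \<tau>] by blast
      moreover have "eigL i \<in> polygon k eigL" if "i \<in> {1..k}" for i
        using that by (simp add: polygon_def hull_inc)
      moreover have "eigL \<tau> \<noteq> eigL (cyclic_succ k \<tau>)"
        using vertices[OF 3] \<tau> cyclic_succ_in[OF \<tau>] cyclic_succ_neq[OF k, of \<tau>]
        unfolding consecutive_vertices_def inj_on_def by metis
      ultimately show ?thesis by blast
    qed
  qed
  show ?thesis
  proof (intro conjI ballI impI)
    show "?K = numerical_range (levinger (conj_transpose P ** A ** P) \<alpha> \<beta>)"
      by (simp add: levinger_compression)
    show "numerical_range (levinger (conj_transpose P ** A ** P) \<alpha> \<beta>) \<subseteq> polygon k eigL"
      using K hyperplane_range_subset_polygon by (simp add: levinger_compression)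
    show "consecutive_vertices k eigL" if "\<alpha> \<noteq> 0 \<and> \<beta> \<noteq> 0"
      using that vertices by blast
  next
    fix \<tau> assume \<tau>: "\<tau> \<in> {1..k}" and c: "c \<tau> \<noteq> 0 \<or> c (cyclic_succ k \<tau>) \<noteq> 0"
    show "\<mu>L \<tau> \<in> closed_segment (eigL \<tau>) (eigL (cyclic_succ k \<tau>))"
      unfolding muL by (rule edge_point_in_closed_segment[OF c])
    obtain a b where a: "a \<noteq> 0" "a \<bullet> eigL \<tau> = b" "a \<bullet> eigL (cyclic_succ k \<tau>) = b"
      "\<And>i. i \<in> {1..k} \<Longrightarrow> a \<bullet> eigL i \<le> b"
      "eigL \<tau> \<noteq> eigL (cyclic_succ k \<tau>) \<or> (\<forall>i\<in>{1..k}. a \<bullet> eigL i = b)"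
      using support[OF \<tau>] by blast
    show "\<exists>L. closed_segment (eigL \<tau>) (eigL (cyclic_succ k \<tau>)) \<subseteq> L \<and>
        touching_line ?K (\<mu>L \<tau>) L \<and>
        ((\<forall>j\<in>{1..k}. c j \<noteq> 0) \<longrightarrow> tangent_line (frontier ?K) (\<mu>L \<tau>) L)"
      unfolding K muL by (rule support_line_tangent[OF k \<tau> a c])
  qed
qed

end
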